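(* Each of the following tasks can be performed by an algorithm using $O(n^{3/2})$ operations, with an absolute implied constant: (a) given $n\ge1$, compute the list $P(0),P(1),\dots,P(n)$; (b) given $n\ge 1$, compute the list $Q(0),Q(1),\dots,Q(n)$; (c) given integers $n\ge 1$ and $1\le m\le n$, compute $Q(n,m)$.
   Context: $P(n)$ is the number of integer partitions of $n$ (with $P(0)=1$). $Q(n)$ is the number of integer partitions of $n$ into distinct parts (with $Q(0)=1$). $Q(n,m)$ is the number of integer partitions of $n$ into exactly $m$ distinct (positive) parts. Complexity is measured in the uniform unit-cost model: an algorithm is a single program (independent of the input) on a random access machine, and each addition, subtraction, multiplication or comparison of integers and each array access counts as one operation, regardless of the size of the integers. *)

theory Defs
  imports Complex_Main "HOL-Library.Multiset"
begin

section \<open>Integer partitions\<close>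

text \<open>A partition of \<open>n\<close> is the multiset of its (positive) parts.\<close>

definition partitions :: "nat \<Rightarrow> nat multiset set" where
  "partitions n = {M. 0 \<notin># M \<and> \<Sum>\<^sub># M = n}"

definition distinct_parts :: "nat multiset \<Rightarrow> bool" where
  "distinct_parts M \<longleftrightarrow> (\<forall>k. count M k \<le> 1)"

definition P :: "nat \<Rightarrow> nat" where
  "P n = card (partitions n)"

definition Q :: "nat \<Rightarrow> nat" where
  "Q n = card {M \<in> partitions n. distinct_parts M}"

definition Q_parts :: "nat \<Rightarrow> nat \<Rightarrow> nat" where
  "Q_parts n m = card {M \<in> partitions n. distinct_parts M \<and> size M = m}"

text \<open>The cardinalities above are taken of finite sets.\<close>

lemma finite_partitions: "finite (partitions n)"
proof -
  have "partitions n \<subseteq> mset ` {xs. set xs \<subseteq> {..n} \<and> length xs \<le> n}"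
  proof
    fix M assume "M \<in> partitions n"
    then have pos: "0 \<notin># M" and sum: "\<Sum>\<^sub># M = n"
      by (auto simp: partitions_def)
    have "size M \<le> \<Sum>\<^sub># M"
      using pos by (induction M) auto
    moreover have "k \<le> n" if "k \<in># M" for k
      using that sum by (metis le_add1 multi_member_split sum_mset.add_mset)
    moreover obtain xs where "mset xs = M"
      using ex_mset by blast
    ultimately show "M \<in> mset ` {xs. set xs \<subseteq> {..n} \<and> length xs \<le> n}"
      using sum by (force intro!: image_eqI[of _ _ xs])
  qed
  then show ?thesis
    by (rule finite_subset) (simp add: finite_lists_length_le)
qed


section \<open>Unit-cost random access machine\<close>

text \<open>
  The machine has integer registers, named directly by the program, and an integer array
  indexed by the natural numbers, accessed indirectly through registers. Since a program is a
  finite list of instructions, it names only finitely many registers and constants.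
  Each executed instruction costs one operation, whatever the size of the integers involved.
  Besides arithmetic, comparisons and array accesses this also charges for the loading of
  constants. There is no division.
\<close>

datatype instr =
    Const nat int          \<comment> \<open>\<open>R i := z\<close>\<close>
  | Add nat nat nat        \<comment> \<open>\<open>R i := R j + R k\<close>\<close>
  | Sub nat nat nat        \<comment> \<open>\<open>R i := R j - R k\<close>\<close>
  | Mul nat nat nat        \<comment> \<open>\<open>R i := R j * R k\<close>\<close>
  | Load nat nat           \<comment> \<open>\<open>R i := A[R j]\<close>\<close>
  | Store nat nat          \<comment> \<open>\<open>A[R i] := R j\<close>\<close>
  | JumpLess nat nat nat   \<comment> \<open>\<open>if R i < R j then goto l\<close>\<close>
  | JumpEq nat nat nat     \<comment> \<open>\<open>if R i = R j then goto l\<close>\<close>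

type_synonym program = "instr list"

record config =
  pc :: nat
  reg :: "nat \<Rightarrow> int"
  arr :: "nat \<Rightarrow> int"

definition set_reg :: "nat \<Rightarrow> int \<Rightarrow> config \<Rightarrow> config" where
  "set_reg i z c = c\<lparr>pc := Suc (pc c), reg := (reg c)(i := z)\<rparr>"

text \<open>An array access with a negative index is a fault (\<open>None\<close>).\<close>

fun exec_instr :: "instr \<Rightarrow> config \<Rightarrow> config option" where
  "exec_instr (Const i z) c = Some (set_reg i z c)"
| "exec_instr (Add i j k) c = Some (set_reg i (reg c j + reg c k) c)"
| "exec_instr (Sub i j k) c = Some (set_reg i (reg c j - reg c k) c)"
| "exec_instr (Mul i j k) c = Some (set_reg i (reg c j * reg c k) c)"
| "exec_instr (Load i j) c =
    (if reg c j < 0 then None else Some (set_reg i (arr c (nat (reg c j))) c))"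
| "exec_instr (Store i j) c =
    (if reg c i < 0 then None
     else Some (c\<lparr>pc := Suc (pc c), arr := (arr c)(nat (reg c i) := reg c j)\<rparr>))"
| "exec_instr (JumpLess i j l) c =
    Some (c\<lparr>pc := (if reg c i < reg c j then l else Suc (pc c))\<rparr>)"
| "exec_instr (JumpEq i j l) c =
    Some (c\<lparr>pc := (if reg c i = reg c j then l else Suc (pc c))\<rparr>)"

definition halted :: "program \<Rightarrow> config \<Rightarrow> bool" where
  "halted p c \<longleftrightarrow> length p \<le> pc c"

definition step :: "program \<Rightarrow> config \<Rightarrow> config option" where
  "step p c = (if halted p c then None else exec_instr (p ! pc c) c)"

fun run :: "program \<Rightarrow> nat \<Rightarrow> config \<Rightarrow> config option" where
  "run p 0 c = Some c"
| "run p (Suc t) c = Option.bind (step p c) (run p t)"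

text \<open>The inputs are in registers \<open>0, 1, \<dots>\<close>; all other registers and all array cells are \<open>0\<close>.\<close>

definition init_config :: "int list \<Rightarrow> config" where
  "init_config xs =
    \<lparr>pc = 0, reg = (\<lambda>i. if i < length xs then xs ! i else 0), arr = (\<lambda>_. 0)\<rparr>"

text \<open>On input \<open>xs\<close>, \<open>p\<close> halts after exactly \<open>t\<close> operations, in configuration \<open>c\<close>.\<close>

definition halts_in :: "program \<Rightarrow> int list \<Rightarrow> nat \<Rightarrow> config \<Rightarrow> bool" where
  "halts_in p xs t c \<longleftrightarrow> run p t (init_config xs) = Some c \<and> halted p c"

text \<open>A list is output in array cells \<open>0, 1, \<dots>\<close>; a single number in register \<open>0\<close>.\<close>

definition outputs_list :: "config \<Rightarrow> int list \<Rightarrow> bool" where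
  "outputs_list c ys \<longleftrightarrow> (\<forall>i < length ys. arr c i = ys ! i)"

definition outputs_number :: "config \<Rightarrow> int \<Rightarrow> bool" where
  "outputs_number c y \<longleftrightarrow> reg c 0 = y"

end

theory Submission
  imports Defs "HOL-Library.Discrete_Functions"
begin

text \<open>
  Every row of the tables used here arises from the previous one by a recurrence
  \<open>F (r + 1) k = F (r + 1) (k - a) + F r (k - d)\<close>, so that a row costs \<open>O(n)\<close>, and \<open>O(\<surd>n)\<close> rows suffice.
  A partition of \<open>n\<close> into \<open>j\<close> distinct parts has \<open>j (j + 1) \<le> 2 n\<close>; the row for \<open>j\<close> parts has
  \<open>a = d = j\<close>. For unrestricted partitions let \<open>s = \<lfloor>\<surd>n\<rfloor>\<close>. The rows with \<open>a = i\<close>, \<open>d = 0\<close> for \<open>i \<le> s\<close>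
  count the partitions with all parts at most \<open>i\<close>. They are continued by the rows with \<open>a = j\<close>,
  \<open>d = s + 1\<close> for \<open>j \<le> s\<close>, which count the partitions with exactly \<open>j\<close> parts greater than \<open>s\<close>:
  either a part \<open>s + 1\<close> is removed, or all \<open>j\<close> large parts are decreased by 1.
\<close>

section \<open>Recurrences\<close>

lemma card_disjoint_images:
  assumes "S = f ` A \<union> g ` B" "f ` A \<inter> g ` B = {}" "inj_on f A" "inj_on g B" "finite S"
  shows "card S = card A + card B"
  using assms by (simp add: card_Un_disjoint card_image)

lemma size_le_sum_mset:
  "0 \<notin># M \<Longrightarrow> size M \<le> \<Sum>\<^sub># (M :: nat multiset)"
  by (induction M) auto

lemma sum_mset_Suc: "\<Sum>\<^sub># (image_mset Suc M) = \<Sum>\<^sub># M + size M"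
  by (induction M) auto

lemma image_mset_Suc_pred: "0 \<notin># M \<Longrightarrow> image_mset Suc (image_mset (\<lambda>x. x - 1) M) = M"
  by (induction M) auto

lemma distinct_parts_image_Suc: "distinct_parts (image_mset Suc M) \<longleftrightarrow> distinct_parts M"
proof -
  have 1: "count (image_mset Suc M) (Suc k) = count M k" for k
    by (induction M) auto
  have 2: "count (image_mset Suc M) 0 = 0"
    by (induction M) auto
  show ?thesis
    unfolding distinct_parts_def by (metis 1 2 not0_implies_Suc le0)
qed

lemma distinct_parts_add_0: "distinct_parts (add_mset 0 M) \<longleftrightarrow> distinct_parts M \<and> 0 \<notin># M"
proof -
  have "count (add_mset 0 M) k = (if k = 0 then Suc (count M 0) else count M k)" for k
    by simp
  then show ?thesis
    unfolding distinct_parts_def not_in_iff by (auto split: if_splits)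
qed

text \<open>Subtracting 1 from every part turns a smallest part 1 into a part 0, which is dropped.\<close>

lemma Q_parts_rec:
  assumes "j \<ge> 1"
  shows "Q_parts k j = (if j \<le> k then Q_parts (k - j) j + Q_parts (k - j) (j - 1) else 0)"
proof (cases "j \<le> k")
  case True
  let ?A = "\<lambda>k j. {M \<in> partitions k. distinct_parts M \<and> size M = j}"
  let ?f = "image_mset Suc" and ?g = "\<lambda>M. image_mset Suc (add_mset 0 M)"
  have "card (?A k j) = card (?A (k - j) j) + card (?A (k - j) (j - 1))"
  proof (rule card_disjoint_images)
    show "?A k j = ?f ` ?A (k - j) j \<union> ?g ` ?A (k - j) (j - 1)"
    proof (intro equalityI subsetI)
      fix M assume M: "M \<in> ?A k j"
      define M' where "M' = image_mset (\<lambda>x. x - 1) M"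
      have MM': "M = image_mset Suc M'"
        using M unfolding M'_def by (subst image_mset_Suc_pred) (auto simp: partitions_def)
      have M': "distinct_parts M'" "size M' = j" "\<Sum>\<^sub># M' + j = k"
        using M by (auto simp: MM' distinct_parts_image_Suc sum_mset_Suc partitions_def)
      show "M \<in> ?f ` ?A (k - j) j \<union> ?g ` ?A (k - j) (j - 1)"
      proof (cases "0 \<in># M'")
        case False
        then show ?thesis using M' MM' by (auto simp: partitions_def)
      next
        case True
        then obtain L where L: "M' = add_mset 0 L" by (metis multi_member_split)
        have "L \<in> ?A (k - j) (j - 1)"
          using M' unfolding L by (auto simp: partitions_def distinct_parts_add_0)
        then show ?thesis using MM' L by blast
      qed
    next
      fix M assume "M \<in> ?f ` ?A (k - j) j \<union> ?g ` ?A (k - j) (j - 1)"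
      then consider L where "L \<in> ?A (k - j) j" "M = ?f L"
        | L where "L \<in> ?A (k - j) (j - 1)" "M = ?g L" by blast
      then show "M \<in> ?A k j"
      proof cases
        case 1
        then show ?thesis using True
          by (auto simp: partitions_def distinct_parts_image_Suc sum_mset_Suc)
      next
        case 2
        then have "distinct_parts (add_mset 0 L)" "size (add_mset 0 L) = j"
          "\<Sum>\<^sub># (add_mset 0 L) = k - j"
          using assms by (auto simp: partitions_def distinct_parts_add_0)
        then show ?thesis using True unfolding 2(2)
          by (simp add: partitions_def distinct_parts_image_Suc sum_mset_Suc 
              del: image_mset_add_mset sum_mset.add_mset size_add_mset) auto
      qed
    qed
    \<comment> \<open>Images under \<open>?g\<close> contain the part 1; those under
      \<open>?f\<close> do not, since partitions have no part 0.\<close>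
    show "?f ` ?A (k - j) j \<inter> ?g ` ?A (k - j) (j - 1) = {}"
    proof -
      have "Suc 0 \<notin># ?f M" if "M \<in> ?A (k - j) j" for M
        using that by (auto simp: partitions_def)
      moreover have "Suc 0 \<in># ?g M" for M by simp
      ultimately show ?thesis by (metis (no_types, lifting) disjoint_iff imageE)
    qed
    show "inj_on ?f (?A (k - j) j)" 
      by (rule inj_on_subset[OF multiset.inj_map]) auto
    show "inj_on ?g (?A (k - j) (j - 1))"
      by (auto intro!: inj_onI dest: injD[OF multiset.inj_map[OF inj_Suc]])
    show "finite (?A k j)" using finite_partitions by simp
  qed
  then show ?thesis using True by (simp add: Q_parts_def)
next
  case False
  then have "{M \<in> partitions k. distinct_parts M \<and> size M = j} = {}"
    using size_le_sum_mset by (fastforce simp: partitions_def)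
  then show ?thesis using False unfolding Q_parts_def by (simp only: card.empty if_False)
qed

lemma Q_parts_0: "Q_parts k 0 = (if k = 0 then 1 else 0)"
proof -
  have "{M \<in> partitions k. distinct_parts M \<and> size M = 0} = (if k = 0 then {{#}} else {})"
    by (auto simp: partitions_def distinct_parts_def)
  then show ?thesis by (simp add: Q_parts_def)
qed

text \<open>The least sum of \<open>j\<close> distinct positive parts is \<open>1 + ... + j\<close>.
  The recurrence passes the bound on to both summands, because
  \<open>(j - 1) * j = j * (j + 1) - 2 * j\<close>.\<close>

lemma Q_parts_eq_0: "2 * k < j * (j + 1) \<Longrightarrow> Q_parts k j = 0"
proof (induction k arbitrary: j rule: less_induct)
  case (less k)
  have j: "j \<ge> 1" using less.prems by (cases j) auto
  show ?case
  proof (cases "j \<le> k")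
    case True
    have "Q_parts (k - j) j = 0"
      using less.prems True j by (intro less.IH) auto
    moreover have "Q_parts (k - j) (j - 1) = 0"
    proof (intro less.IH)
      obtain i where "j = Suc i" using j by (cases j) auto
      then show "2 * (k - j) < (j - 1) * (j - 1 + 1)"
        using less.prems True by (auto simp: algebra_simps)
    qed (use j True in auto)
    ultimately show ?thesis using Q_parts_rec[OF j, of k] by simp
  qed (simp add: Q_parts_rec[OF j])
qed

lemma card_by_value:
  fixes f :: "'a \<Rightarrow> nat"
  assumes "finite A" "\<And>x. x \<in> A \<Longrightarrow> f x \<le> l"
  shows "card A = (\<Sum>j\<le>l. card {x \<in> A. f x = j})"
proof -
  have "A = (\<Union>j\<in>{..l}. {x \<in> A. f x = j})" using assms by auto
  then have "card A = card (\<Union>j\<in>{..l}. {x \<in> A. f x = j})" by simp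
  also have "\<dots> = (\<Sum>j\<le>l. card {x \<in> A. f x = j})"
    using assms(1) by (intro card_UN_disjoint) auto
  finally show ?thesis .
qed

text \<open>If \<open>j > l\<close> then \<open>j * (j + 1) \<ge> (l + 1)^2 > 2 * n\<close>, so such
  sizes do not occur. The bound refers to \<open>n\<close>, so one \<open>l\<close> serves all
  \<open>k \<le> n\<close>.\<close>

lemma Q_eq_sum:
  assumes "k \<le> n" "2 * n < (l + 1)\<^sup>2"
  shows "Q k = (\<Sum>j\<le>l. Q_parts k j)"
proof -
  let ?A = "{M \<in> partitions k. distinct_parts M}"
  have fin: "finite ?A" using finite_partitions by simp
  have "size M \<le> l" if "M \<in> ?A" for M
  proof (rule ccontr)
    assume "\<not> size M \<le> l"
    then have "(l + 1)\<^sup>2 \<le> size M * size M"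
      unfolding power2_eq_square by (intro mult_mono) auto
    then have "Q_parts k (size M) = 0"
      using assms by (intro Q_parts_eq_0) auto
    moreover have "M \<in> {N \<in> partitions k. distinct_parts N \<and> size N = size M}"
      using that by simp
    ultimately show False
      using finite_partitions by (auto simp: Q_parts_def)
  qed
  from card_by_value[OF fin this] show ?thesis
    by (simp add: Q_def Q_parts_def conj_assoc)
qed

section \<open>Partitions by their number of large parts\<close>

text \<open>For \<open>j = 0\<close> these are the partitions with all parts at most
  \<open>s\<close>, so one family covers both kinds of rows.\<close>

definition partitions_big :: "nat \<Rightarrow> nat \<Rightarrow> nat \<Rightarrow> nat multiset set" where
  "partitions_big s j k = {M \<in> partitions k. size (filter_mset (\<lambda>x. s < x) M) = j}"

definition P_big :: "nat \<Rightarrow> nat \<Rightarrow> nat \<Rightarrow> nat" where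
  "P_big s j k = card (partitions_big s j k)"

lemma finite_partitions_big: "finite (partitions_big s j k)"
  using finite_partitions by (simp add: partitions_big_def)

lemma P_big_0_0: "P_big 0 0 k = (if k = 0 then 1 else 0)"
proof -
  have "partitions_big 0 0 k = (if k = 0 then {{#}} else {})"
  proof -
    have "M = {#}" if "M \<in> partitions_big 0 0 k" for M
    proof (rule ccontr)
      assume "M \<noteq> {#}"
      then obtain x where "x \<in># M" by blast
      then show False using that by (auto simp: partitions_big_def partitions_def)
    qed
    moreover have "{#} \<in> partitions_big 0 0 k \<longleftrightarrow> k = 0"
      by (auto simp: partitions_big_def partitions_def)
    ultimately show ?thesis by auto
  qed
  then show ?thesis by (simp add: P_big_def)
qed

text \<open>Either \<open>i\<close> is a part and one copy is removed, or all parts are at most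
  \<open>i - 1\<close>.\<close>

lemma P_big_small_rec:
  assumes "i \<ge> 1"
  shows "P_big i 0 k = (if i \<le> k then P_big i 0 (k - i) else 0) + P_big (i - 1) 0 k"
proof -
  let ?A = "if i \<le> k then partitions_big i 0 (k - i) else {}"
  have "card (partitions_big i 0 k) = card ?A + card (partitions_big (i - 1) 0 k)"
  proof (rule card_disjoint_images)
    show "partitions_big i 0 k = add_mset i ` ?A \<union> id ` partitions_big (i - 1) 0 k"
    proof (intro equalityI subsetI)
      fix M assume M: "M \<in> partitions_big i 0 k"
      show "M \<in> add_mset i ` ?A \<union> id ` partitions_big (i - 1) 0 k"
      proof (cases "i \<in># M")
        case True
        then obtain L where L: "M = add_mset i L" by (metis multi_member_split)
        then have "L \<in> ?A" using M by (auto simp: partitions_big_def partitions_def)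
        then show ?thesis using L by blast
      next
        case False
        have "x \<le> i - 1" if "x \<in># M" for x
        proof -
          have "x \<le> i" using that M by (auto simp: partitions_big_def not_less)
          moreover have "x \<noteq> i" using that False by auto
          ultimately show ?thesis by simp
        qed
        then have "\<forall>x\<in>#M. \<not> i - 1 < x" by (meson not_less)
        then show ?thesis
          using M by (auto simp: partitions_big_def)
      qed
    next
      fix M assume "M \<in> add_mset i ` ?A \<union> id ` partitions_big (i - 1) 0 k"
      then show "M \<in> partitions_big i 0 k"
        using assms
        by (fastforce simp: partitions_big_def partitions_def
            split: if_splits)
    qed
    show "add_mset i ` ?A \<inter> id ` partitions_big (i - 1) 0 k = {}"
      using assms by (fastforce simp: partitions_big_def)
  qed (auto simp: inj_on_def finite_partitions_big)
  then show ?thesis by (auto simp: P_big_def)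
qed

text \<open>The map \<open>f\<close> opens a gap at \<open>s + 1\<close>. Large parts stay large and
  each grows by 1, so the sum grows by their number. The last claim inverts \<open>f\<close> on
  multisets that avoid the gap.\<close>

lemma partitions_big_lift:
  fixes s :: nat
  defines "f \<equiv> \<lambda>x. if s < x then Suc x else x"
  shows "inj f"
    "0 \<in># image_mset f M \<longleftrightarrow> 0 \<in># M"
    "\<Sum>\<^sub># (image_mset f M) = \<Sum>\<^sub># M + size (filter_mset (\<lambda>x. s < x) M)"
    "size (filter_mset (\<lambda>x. s < x) (image_mset f M)) = size (filter_mset (\<lambda>x. s < x) M)"
    "Suc s \<notin># M \<Longrightarrow> M = image_mset f (image_mset (\<lambda>x. if s < x then x - 1 else x) M)"
proof -
  show "inj f" by (auto simp: inj_def f_def)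
  show "0 \<in># image_mset f M \<longleftrightarrow> 0 \<in># M" by (auto simp: f_def)
  show "\<Sum>\<^sub># (image_mset f M) = \<Sum>\<^sub># M + size (filter_mset (\<lambda>x. s < x) M)"
    by (induction M) (auto simp: f_def)
  show "size (filter_mset (\<lambda>x. s < x) (image_mset f M)) = size (filter_mset (\<lambda>x. s < x) M)"
    by (induction M) (auto simp: f_def)
  show "Suc s \<notin># M \<Longrightarrow> M = image_mset f (image_mset (\<lambda>x. if s < x then x - 1 else x) M)"
    by (induction M) (auto simp: f_def)
qed

text \<open>Split by whether \<open>s + 1\<close> is a part. If it is not, all large parts are at
  least \<open>s + 2\<close> and remain large when decreased by 1.\<close>

lemma P_big_rec:
  assumes "j \<ge> 1"
  shows "P_big s j k = (if j \<le> k then P_big s j (k - j) else 0) +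
    (if s + 1 \<le> k then P_big s (j - 1) (k - (s + 1)) else 0)"
proof -
  define f where "f = (\<lambda>x. if s < x then Suc x else x)"
  note lift = partitions_big_lift[of s, folded f_def]
  let ?A = "if j \<le> k then partitions_big s j (k - j) else {}"
  let ?B = "if s + 1 \<le> k then partitions_big s (j - 1) (k - (s + 1)) else {}"
  have "card (partitions_big s j k) = card ?A + card ?B"
  proof (rule card_disjoint_images)
    show "partitions_big s j k = image_mset f ` ?A \<union> add_mset (Suc s) ` ?B"
    proof (intro equalityI subsetI)
      fix M assume M: "M \<in> partitions_big s j k"
      show "M \<in> image_mset f ` ?A \<union> add_mset (Suc s) ` ?B"
      proof (cases "Suc s \<in># M")
        case True
        then obtain L where L: "M = add_mset (Suc s) L" by (metis multi_member_split)
        then have "L \<in> ?B" using M by (auto simp: partitions_big_def partitions_def)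
        then show ?thesis using L by blast
      next
        case False
        from lift(5)[OF this] obtain L where L: "M = image_mset f L" by blast
        then have "L \<in> ?A"
          using M by (auto simp: partitions_big_def partitions_def lift(2-4) simp del: set_image_mset)
        then show ?thesis using L by blast
      qed
    next
      fix M assume "M \<in> image_mset f ` ?A \<union> add_mset (Suc s) ` ?B"
      then show "M \<in> partitions_big s j k"
        using assms by (auto simp: partitions_big_def partitions_def lift(2-4)
            simp del: set_image_mset split: if_splits)
    qed
    have "Suc s \<notin># image_mset f M" for M by (auto simp: f_def)
    then show "image_mset f ` ?A \<inter> add_mset (Suc s) ` ?B = {}"
      by (metis (no_types, lifting) disjoint_iff imageE union_single_eq_member)
    show "inj_on (image_mset f) ?A"
      by (rule inj_on_subset[OF multiset.inj_map[OF lift(1)]]) simp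
  qed (auto simp: inj_on_def finite_partitions_big)
  then show ?thesis by (auto simp: P_big_def)
qed

text \<open>Each of the \<open>j\<close> large parts is at least \<open>s + 1\<close>; the proof
  again follows the recurrence.\<close>

lemma P_big_eq_0: "k < j * (s + 1) \<Longrightarrow> P_big s j k = 0"
proof (induction k arbitrary: j rule: less_induct)
  case (less k)
  have j: "j \<ge> 1" using less.prems by (cases j) auto
  have "P_big s j (k - j) = 0" if "j \<le> k"
    using less.prems that j by (intro less.IH) auto
  moreover have "P_big s (j - 1) (k - (s + 1)) = 0" if "s + 1 \<le> k"
    using less.prems that j by (intro less.IH) (auto simp: algebra_simps diff_mult_distrib)
  ultimately show ?case using P_big_rec[OF j, of s k] by auto
qed

text \<open>More than \<open>s\<close> parts above \<open>s\<close> would sum to at least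
  \<open>(s + 1)^2 > n\<close>.\<close>

lemma P_eq_sum:
  assumes "k \<le> n" "n < (s + 1)\<^sup>2"
  shows "P k = (\<Sum>j\<le>s. P_big s j k)"
proof -
  let ?b = "\<lambda>M. size (filter_mset (\<lambda>x. s < x) M)"
  have "?b M \<le> s" if "M \<in> partitions k" for M
  proof (rule ccontr)
    assume "\<not> ?b M \<le> s"
    then have "(s + 1)\<^sup>2 \<le> ?b M * (s + 1)"
      unfolding power2_eq_square by (intro mult_mono) auto
    then have "P_big s (?b M) k = 0"
      using assms by (intro P_big_eq_0) auto
    moreover have "M \<in> partitions_big s (?b M) k"
      using that by (simp add: partitions_big_def)
    ultimately show False
      using finite_partitions_big by (auto simp: P_big_def)
  qed
  from card_by_value[OF finite_partitions this] show ?thesis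
    by (simp add: P_def P_big_def partitions_big_def)
qed

section \<open>Structured programs\<close>

text \<open>A fragment is given the address at which it is placed, since jump targets are absolute.\<close>

type_synonym fragment = "nat \<Rightarrow> instr list"

text \<open>The arbitrary surroundings \<open>ys\<close> and \<open>zs\<close> allow embedding into
  any program; control enters at the first instruction and leaves just behind the last.\<close>

definition does :: "fragment \<Rightarrow> nat \<Rightarrow> config \<Rightarrow> config \<Rightarrow> bool" where
  "does f t c c' \<longleftrightarrow> pc c' = pc c + length (f (pc c)) \<and>
     (\<forall>ys zs. length ys = pc c \<longrightarrow> run (ys @ f (pc c) @ zs) t c = Some c')"

definition seq :: "fragment \<Rightarrow> fragment \<Rightarrow> fragment" where
  "seq f g l = f l @ g (l + length (f l))"

text \<open>The test follows the body, so the body runs at least once and a pass needs only one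
  jump.\<close>

definition repeat_while_less :: "fragment \<Rightarrow> nat \<Rightarrow> nat \<Rightarrow> fragment" where
  "repeat_while_less f i j l = f l @ [JumpLess i j l]"

fun straight :: "instr \<Rightarrow> bool" where
  "straight (JumpLess _ _ _) = False"
| "straight (JumpEq _ _ _) = False"
| "straight _ = True"

text \<open>Straight-line code is evaluated without fetching instructions by address, so
  simplification can execute it symbolically.\<close>

fun exec_block :: "instr list \<Rightarrow> config \<Rightarrow> config option" where
  "exec_block [] c = Some c"
| "exec_block (i # is) c = Option.bind (exec_instr i c) (exec_block is)"

lemma run_add: "run p (t + u) c = Option.bind (run p t c) (run p u)"
  by (induction t arbitrary: c) (auto simp: Option.bind_assoc intro!: arg_cong2[of _ _ _ _ Option.bind])

lemma does_seq:
  assumes "does f t c c'" "does g u c' c''"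
  shows "does (seq f g) (t + u) c c''"
  unfolding does_def
proof (intro conjI allI impI)
  show "pc c'' = pc c + length (seq f g (pc c))"
    using assms by (simp add: does_def seq_def)
  fix ys zs :: program assume l: "length ys = pc c"
  let ?g = "g (pc c')"
  have c': "pc c' = pc c + length (f (pc c))" using assms(1) by (simp add: does_def)
  have "run (ys @ f (pc c) @ (?g @ zs)) t c = Some c'"
    using assms(1) l by (simp add: does_def)
  moreover have "run ((ys @ f (pc c)) @ ?g @ zs) u c' = Some c''"
    using assms(2) l c' unfolding does_def by (metis length_append)
  ultimately show "run (ys @ seq f g (pc c) @ zs) (t + u) c = Some c''"
    by (simp add: run_add seq_def c')
qed

lemma run_Suc_0: "run p (Suc 0) c = step p c"
  by (cases "step p c") auto

lemma does_instr:
  assumes "straight i" "exec_instr i c = Some c'"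
  shows "does (\<lambda>_. [i]) 1 c c'"
proof -
  have "pc c' = Suc (pc c)"
    using assms by (cases i) (auto simp: set_reg_def split: if_splits)
  then show ?thesis
    using assms(2) by (simp add: does_def run_Suc_0 step_def halted_def nth_append)
qed

lemma does_block:
  assumes "list_all straight is" "exec_block is c = Some c'"
  shows "does (\<lambda>_. is) (length is) c c'"
  using assms
proof (induction "is" arbitrary: c)
  case Nil
  then show ?case by (simp add: does_def)
next
  case (Cons i "is")
  then obtain d where d: "exec_instr i c = Some d" "exec_block is d = Some c'"
    by (cases "exec_instr i c") auto
  have "does (seq (\<lambda>_. [i]) (\<lambda>_. is)) (1 + length is) c c'"
    using Cons d by (intro does_seq does_instr) auto
  then show ?case by (simp add: seq_def[abs_def])
qed

lemma does_repeat:
  assumes "does f t c c'"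
  shows "\<not> reg c' i < reg c' j \<Longrightarrow>
      does (repeat_while_less f i j) (t + 1) c (c'\<lparr>pc := Suc (pc c')\<rparr>)"
    and "reg c' i < reg c' j \<Longrightarrow> does (repeat_while_less f i j) u (c'\<lparr>pc := pc c\<rparr>) c'' \<Longrightarrow>
      does (repeat_while_less f i j) (t + 1 + u) c c''"
proof -
  have c': "pc c' = pc c + length (f (pc c))" using assms(1) by (simp add: does_def)
  have run: "run (ys @ repeat_while_less f i j (pc c) @ zs) (t + 1) c =
    Some (c'\<lparr>pc := (if reg c' i < reg c' j then pc c else Suc (pc c'))\<rparr>)"
    if "length ys = pc c" for ys zs
  proof -
    have "run (ys @ f (pc c) @ (JumpLess i j (pc c) # zs)) t c = Some c'"
      using assms that by (simp add: does_def)
    then show ?thesis using that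
      unfolding run_add repeat_while_less_def
      by (simp add: run_Suc_0 step_def halted_def nth_append c')
  qed
  {
    assume "\<not> reg c' i < reg c' j"
    then show "does (repeat_while_less f i j) (t + 1) c (c'\<lparr>pc := Suc (pc c')\<rparr>)"
      using run c' by (simp add: does_def repeat_while_less_def)
  next
    assume "reg c' i < reg c' j" and *: "does (repeat_while_less f i j) u (c'\<lparr>pc := pc c\<rparr>) c''"
    then show "does (repeat_while_less f i j) (t + 1 + u) c c''"
      unfolding does_def run_add[of _ "t + 1" u] by (auto simp: run[unfolded One_nat_def]
          simp del: run.simps add_Suc_right)
  }
qed

section \<open>Triples with exact running time\<close>

type_synonym assertion = "(nat \<Rightarrow> int) \<Rightarrow> (nat \<Rightarrow> int) \<Rightarrow> bool"

text \<open>Assertions see registers and array but not the program counter, so a triple holds at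
  every address.\<close>

definition triple :: "assertion \<Rightarrow> fragment \<Rightarrow> nat \<Rightarrow> assertion \<Rightarrow> bool" where
  "triple A f t B \<longleftrightarrow>
     (\<forall>c. A (reg c) (arr c) \<longrightarrow> (\<exists>c'. does f t c c' \<and> B (reg c') (arr c')))"

lemma triple_seq: "triple A f t B \<Longrightarrow> triple B g u C \<Longrightarrow> triple A (seq f g) (t + u) C"
  unfolding triple_def by (meson does_seq)

lemma triple_block:
  assumes "list_all straight is" "length is = t"
    and "\<And>c. A (reg c) (arr c) \<Longrightarrow>
      \<exists>c'. exec_block is c = Some c' \<and> B (reg c') (arr c')"
  shows "triple A (\<lambda>_. is) t B"
  unfolding triple_def using assms does_block by blast

lemma triple_conseq:
  assumes "triple A f t B" "\<And>r a. A' r a \<Longrightarrow> A r a" "\<And>r a. B r a \<Longrightarrow> B' r a"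
  shows "triple A' f t B'"
  using assms unfolding triple_def by blast

text \<open>\<open>I i\<close> describes the state after \<open>i\<close> passes, each of which
  costs the body plus one jump. The test is evaluated only after a pass, whence
  \<open>l \<ge> 1\<close>.\<close>

lemma triple_repeat:
  assumes body: "\<And>i. i < l \<Longrightarrow> triple (I i) f t (I (Suc i))"
    and test: "\<And>i r a. i < l \<Longrightarrow> I (Suc i) r a \<Longrightarrow> r x < r y \<longleftrightarrow> Suc i < l"
    and "l \<ge> 1"
  shows "triple (I 0) (repeat_while_less f x y) (l * (t + 1)) (I l)"
proof -
  \<comment> \<open>Here \<open>m\<close> is the number of passes still to be made.\<close>
  have "triple (I (l - m)) (repeat_while_less f x y) (m * (t + 1)) (I l)"
    if "1 \<le> m" "m \<le> l" for m
    using that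
  proof (induction m rule: dec_induct)
    case base
    show ?case unfolding triple_def
    proof (intro allI impI)
      fix c :: config assume "I (l - 1) (reg c) (arr c)"
      with body[of "l - 1"] \<open>l \<ge> 1\<close> obtain c' where c': "does f t c c'" "I l (reg c') (arr c')"
        by (auto simp: triple_def)
      moreover have "\<not> reg c' x < reg c' y"
        using test[of "l - 1"] c' \<open>l \<ge> 1\<close> by auto
      ultimately show
        "\<exists>c'. does (repeat_while_less f x y) (1 * (t + 1)) c c' \<and> I l (reg c') (arr c')"
        using does_repeat(1)[of f t c c' x y]
        by (intro exI[of _ "c'\<lparr>pc := Suc (pc c')\<rparr>"]) simp
    qed
  next
    case (step m)
    then have m: "Suc (l - Suc m) = l - m" "l - Suc m < l" by auto
    show ?case unfolding triple_def
    proof (intro allI impI)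
      fix c :: config assume "I (l - Suc m) (reg c) (arr c)"
      with body[of "l - Suc m"] m
      obtain c' where c': "does f t c c'" "I (l - m) (reg c') (arr c')"
        by (auto simp: triple_def)
      have less: "reg c' x < reg c' y"
        using test[of "l - Suc m"] c' m step by auto
      have "I (l - m) (reg (c'\<lparr>pc := pc c\<rparr>)) (arr (c'\<lparr>pc := pc c\<rparr>))"
        using c' by simp
      moreover have "triple (I (l - m)) (repeat_while_less f x y) (m * (t + 1)) (I l)"
        using step by simp
      ultimately obtain d where d: "I l (reg d) (arr d)"
        "does (repeat_while_less f x y) (m * (t + 1)) (c'\<lparr>pc := pc c\<rparr>) d"
        unfolding triple_def by blast
      show "\<exists>c'. does (repeat_while_less f x y) (Suc m * (t + 1)) c c' \<and> I l (reg c') (arr c')"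
        using does_repeat(2)[OF c'(1) less d(2)] d(1) by (auto simp: ac_simps)
    qed
  qed
  from this[of l] \<open>l \<ge> 1\<close> show ?thesis by simp
qed

lemma triple_halts_in:
  assumes "triple A f t B" "A (reg (init_config xs)) (\<lambda>_. 0)"
  shows "\<exists>c. halts_in (f 0) xs t c \<and> B (reg c) (arr c)"
proof -
  have "A (reg (init_config xs)) (arr (init_config xs))"
    using assms(2) by (simp add: init_config_def)
  then obtain c where c: "does f t (init_config xs) c" "B (reg c) (arr c)"
    using assms(1) unfolding triple_def by blast
  have pc: "pc (init_config xs) = 0" by (simp add: init_config_def)
  have "run ([] @ f 0 @ []) t (init_config xs) = Some c" "pc c = length (f 0)"
    using c(1) unfolding does_def pc by (simp_all only: list.size add_0_left simp_thms)
  then have "halts_in (f 0) xs t c" by (simp add: halts_in_def halted_def)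
  then show ?thesis using c(2) by blast
qed

section \<open>Filling the table\<close>

text \<open>
  Row \<open>r\<close> of the table occupies the cells \<open>base n r + k\<close> for \<open>k \<le> n\<close>. The \<open>n + 1\<close> cells below each
  row stay \<open>0\<close>, so that entries with a negative index can be read without a test.
  The output is accumulated in the cells \<open>0, \<dots>, n\<close>.
\<close>

definition base :: "nat \<Rightarrow> nat \<Rightarrow> nat" where
  "base n r = 2 * (n + 1) * (r + 1)"

lemma base_0: "base n 0 = 2 * (n + 1)" and base_Suc: "base n (Suc r) = base n r + 2 * (n + 1)"
  by (simp_all add: base_def)

lemma base_mono: "r \<le> r' \<Longrightarrow> base n r \<le> base n r'"
  unfolding base_def by (intro mult_mono) auto

lemma base_ge: "2 * (n + 1) \<le> base n r"
  using base_mono[of 0 r n] by (simp add: base_0)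

text \<open>\<open>R\<close> is the last completed row. Only the gap below it is recorded, as no
  earlier gap is read again. The zeros from \<open>base n R + (n + 1)\<close> on include the gap
  below row \<open>R + 1\<close>.\<close>

definition mem :: "nat \<Rightarrow> nat \<Rightarrow> (nat \<Rightarrow> nat \<Rightarrow> nat) \<Rightarrow> (nat \<Rightarrow> nat) \<Rightarrow> (nat \<Rightarrow> int) \<Rightarrow> bool" where
  "mem n R F out a \<longleftrightarrow>
     (\<forall>k\<le>n. a k = int (out k)) \<and>
     (\<forall>r\<le>R. \<forall>k\<le>n. a (base n r + k) = int (F r k)) \<and>
     (\<forall>x. base n R \<le> x + (n + 1) \<and> x < base n R \<longrightarrow> a x = 0) \<and>
     (\<forall>x\<ge>base n R + (n + 1). a x = 0)"

text \<open>Registers: \<open>j\<close> and \<open>d\<close> are the two shifts of the recurrence for the current row, \<open>e\<close> is the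
  increment of \<open>d\<close> from row to row, \<open>w\<close> is the factor applied to the old output, and rows are
  computed as long as \<open>j\<^sup>2 \<le> v\<close>.\<close>

definition regs :: "nat \<Rightarrow> nat \<Rightarrow> nat \<Rightarrow> nat \<Rightarrow> nat \<Rightarrow> nat \<Rightarrow> nat \<Rightarrow> (nat \<Rightarrow> int) \<Rightarrow> bool" where
  "regs n m j d e w v r \<longleftrightarrow>
     r 0 = int n \<and> r 1 = int m \<and> r 2 = int j \<and> r 3 = int d \<and> r 4 = int e \<and> r 5 = int w \<and>
     r 6 = int v + 1 \<and> r 7 = 1 \<and> r 10 = 2 * (int n + 1) \<and> r 11 = int n + 1"

text \<open>Register 8 holds the column, register 9 the address of the new entry, and register 10
  the distance between rows. The two loads into registers 12 and 13 fetch the entry \<open>j\<close>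
  cells back in the new row and the one \<open>d\<close> cells back in the old row.\<close>

definition row_block :: program where
  "row_block =
    [Sub 12 9 2, Load 12 12, Sub 13 9 10, Sub 13 13 3, Load 13 13, Add 12 12 13, Store 9 12,
     Load 13 8, Mul 13 5 13, Add 13 13 12, Store 8 13, Add 8 8 7, Add 9 9 7]"

definition row_loop :: fragment where
  "row_loop = repeat_while_less (\<lambda>_. row_block) 8 11"

text \<open>No square root is computed: register 14 holds the square of the next \<open>j\<close>.
  Register 9 stands just behind the finished row, and adding \<open>n + 1\<close> skips the next
  gap.\<close>

definition phase :: fragment where
  "phase = repeat_while_less
     (seq (\<lambda>_. [Add 3 3 4, Const 8 0]) (seq row_loop (\<lambda>_. [Add 9 9 11, Add 2 2 7, Mul 14 2 2]))) 14 6"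

section \<open>Correctness of one row\<close>

text \<open>The array once \<open>k\<close> columns of the row at \<open>b\<close> are done, with
  \<open>a\<close> its contents before that row.\<close>

definition written ::
  "nat \<Rightarrow> nat \<Rightarrow> nat \<Rightarrow> (nat \<Rightarrow> nat) \<Rightarrow> (nat \<Rightarrow> int) \<Rightarrow> nat \<Rightarrow> int" where
  "written b k w G a x =
     (if b \<le> x \<and> x < b + k then int (G (x - b))
      else if x < k then int w * a x + int (G x) else a x)"

lemma mem_written:
  assumes "mem n R F out a"
  shows "mem n (Suc R) F (\<lambda>k. w * out k + F (Suc R) k)
    (written (base n (Suc R)) (n + 1) w (F (Suc R)) a)"
proof -
  let ?b = "base n (Suc R)"
  let ?a = "written ?b (n + 1) w (F (Suc R)) a"
  have b: "?b = base n R + 2 * (n + 1)" "2 * (n + 1) \<le> base n R"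
    by (simp_all only: base_Suc base_ge)
  have "?a k = int (w * out k + F (Suc R) k)" if "k \<le> n" for k
    using that assms b by (auto simp: written_def mem_def)
  moreover have "?a (base n r + k) = int (F r k)" if "r \<le> Suc R" "k \<le> n" for r k
  proof (cases "r = Suc R")
    case True
    then show ?thesis using that by (simp add: written_def)
  next
    case False
    then have "r \<le> R" using that by simp
    then have "base n r \<le> base n R" "a (base n r + k) = int (F r k)"
      using assms that base_mono by (auto simp: mem_def)
    moreover have "2 * (n + 1) \<le> base n r" by (rule base_ge)
    ultimately show ?thesis using that b by (simp add: written_def)
  qed
  moreover have "?a x = 0" if "?b \<le> x + (n + 1)" "x < ?b" for x
    using that assms b by (simp add: written_def mem_def)
  moreover have "?a x = 0" if "?b + (n + 1) \<le> x" for x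
    using that assms b by (simp add: written_def mem_def)
  ultimately show ?thesis unfolding mem_def by blast
qed

lemma written_0: "written b 0 w G a = a"
  by (auto simp: written_def)

lemma written_Suc:
  "k < b \<Longrightarrow> written b (Suc k) w G a =
     (written b k w G a)(b + k := int (G k), k := int w * a k + int (G k))"
  by (auto simp: written_def fun_eq_iff less_Suc_eq)

text \<open>A read left of a row hits its gap of \<open>n + 1\<close> zeros, which yields the
  \<open>else 0\<close> cases for shifts up to \<open>n + 1\<close>. By \<open>1 \<le> j\<close> the
  new row is read only where it is already written, and \<open>2 * (n + 1) \<le> b\<close> keeps the
  old gap clear of the output cells.\<close>

lemma triple_row_loop:
  assumes rec: "\<And>k. k \<le> n \<Longrightarrow> G k =
      (if j \<le> k then G (k - j) else 0) + (if d \<le> k then H (k - d) else 0)"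
    and old: "\<And>k. k \<le> n \<Longrightarrow> a0 (b + k) = int (H k)"
    and pad_old: "\<And>x. b \<le> x + (n + 1) \<Longrightarrow> x < b \<Longrightarrow> a0 x = 0"
    and pad_new: "\<And>x. b + (n + 1) \<le> x \<Longrightarrow> a0 x = 0"
    and bounds: "2 * (n + 1) \<le> b" "1 \<le> j" "j \<le> n + 1" "d \<le> n + 1"
  defines "b' \<equiv> b + 2 * (n + 1)"
  shows "triple (\<lambda>r a. regs n m j d e w v r \<and> r 8 = 0 \<and> r 9 = int b' \<and> a = a0)
    row_loop ((n + 1) * 14)
    (\<lambda>r a. regs n m j d e w v r \<and> r 9 = int b' + int n + 1 \<and> a = written b' (n + 1) w G a0)"
proof -
  define I where "I k r a \<longleftrightarrow> regs n m j d e w v r \<and> r 8 = int k \<and> r 9 = int b' + int k \<and>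
    a = written b' k w G a0" for k r a
  have "triple (I 0) row_loop ((n + 1) * (13 + 1)) (I (n + 1))"
    unfolding row_loop_def
  proof (rule triple_repeat)
    fix k assume k: "k < n + 1"
    define x where "x = written b' k w G a0 (b' + k - j)"
    define y where "y = written b' k w G a0 (b + k - d)"
    have x: "x = int (if j \<le> k then G (k - j) else 0)"
      using bounds k pad_new[of "b' + k - j"] unfolding x_def written_def b'_def by auto
    have y: "y = int (if d \<le> k then H (k - d) else 0)"
      using bounds k pad_old[of "b + k - d"] old[of "k - d"]
      unfolding y_def written_def b'_def by auto
    have xy: "x + y = int (G k)" using rec[of k] k unfolding x y by simp
    \<comment> \<open>The nonnegative addresses also show that the loads do not fault.\<close>
    have addr: "nat (int b' + int k - int j) = b' + k - j"
      "nat (int b' + int k - 2 * (int n + 1) - int d) = b + k - d"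
      "nat (int b' + int k) = b' + k"
      "int b' + int k - int j \<ge> 0" "int b' + int k - 2 * (int n + 1) - int d \<ge> 0"
      using bounds by (auto simp: b'_def)
    have kb: "k < b'" using k bounds by (simp add: b'_def)
    have k_old: "written b' k w G a0 k = a0 k" using kb by (simp add: written_def)
    show "triple (I k) (\<lambda>_. row_block) 13 (I (Suc k))"
    proof (rule triple_block)
      show "list_all straight row_block" "length row_block = 13" by (simp_all add: row_block_def)
      fix c :: config assume I: "I k (reg c) (arr c)"
      then show "\<exists>c'. exec_block row_block c = Some c' \<and> I (Suc k) (reg c') (arr c')"
        using addr kb
        by (simp add: I_def row_block_def set_reg_def regs_def written_Suc
            x_def[symmetric] y_def[symmetric] xy k_old)
    qed
  qed (auto simp: I_def regs_def)
  moreover have "13 + 1 = (14 :: nat)" by simp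
  ultimately have "triple (I 0) row_loop ((n + 1) * 14) (I (n + 1))" by argo
  then show ?thesis
    by (rule triple_conseq) (auto simp: I_def written_0)
qed

section \<open>Correctness of a sequence of rows\<close>

text \<open>After \<open>i\<close> passes register 2 already holds the shift for the next row,
  whereas register 3 is advanced only when the next pass begins. Register 14 is first set during the
  first pass, hence the guard \<open>i > 0\<close>.\<close>

definition phase_inv where
  "phase_inv n m d0 e w v R F out i r a \<longleftrightarrow>
     regs n m (i + 1) (d0 + e * i) e w v r \<and> r 9 = int (base n (Suc (R + i))) \<and>
     mem n (R + i) F (out i) a \<and> (i > 0 \<longrightarrow> r 14 = (int i + 1) * (int i + 1))"

text \<open>A pass costs \<open>2 + 14 * (n + 1) + 3\<close> steps and one jump.\<close>

lemma triple_phase: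
  assumes rec: "\<And>i k. i < l \<Longrightarrow> k \<le> n \<Longrightarrow> F (Suc (R + i)) k =
      (if Suc i \<le> k then F (Suc (R + i)) (k - Suc i) else 0) +
      (if d0 + e * Suc i \<le> k then F (R + i) (k - (d0 + e * Suc i)) else 0)"
    and out: "\<And>i. i < l \<Longrightarrow> out (Suc i) = (\<lambda>k. w * out i k + F (Suc (R + i)) k)"
    and l: "l = floor_sqrt v" "1 \<le> l" "l \<le> n + 1" "d0 + e * l \<le> n + 1"
  shows "triple (phase_inv n m d0 e w v R F out 0) phase (l * (14 * n + 20))
    (phase_inv n m d0 e w v R F out l)"
proof -
  let ?I = "phase_inv n m d0 e w v R F out"
  have "triple (?I 0) phase (l * (14 * n + 19 + 1)) (?I l)"
    unfolding phase_def
  proof (rule triple_repeat)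
    fix i assume i: "i < l"
    define d where "d = d0 + e * Suc i"
    have d: "d \<le> n + 1"
    proof -
      have "e * Suc i \<le> e * l" using i by (intro mult_le_mono2) simp
      then show ?thesis using l(4) by (simp add: d_def)
    qed
    let ?b = "base n (Suc (R + i))"
    have b: "?b = base n (R + i) + 2 * (n + 1)" by (rule base_Suc)
    have "triple (?I i)
      (seq (\<lambda>_. [Add 3 3 4, Const 8 0]) (seq row_loop (\<lambda>_. [Add 9 9 11, Add 2 2 7, Mul 14 2 2])))
      (2 + ((n + 1) * 14 + 3)) (?I (Suc i))"
      unfolding triple_def
    proof (intro allI impI)
      fix c :: config assume c: "?I i (reg c) (arr c)"
      \<comment> \<open>The row loop is specified for a fixed initial array, so the current contents
        are frozen.\<close>
      define a where "a = arr c"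
      define A where "A = (\<lambda>r a'. regs n m (Suc i) d e w v r \<and> r 8 = 0 \<and> r 9 = int ?b \<and> a' = a)"
      define A' where "A' = (\<lambda>r a'. regs n m (Suc i) d e w v r \<and> r 9 = int ?b + int n + 1 \<and>
         a' = written ?b (n + 1) w (F (Suc (R + i))) a)"
      have mem: "mem n (R + i) F (out i) a" using c by (simp add: phase_inv_def a_def)
      have "triple (\<lambda>r a'. ?I i r a' \<and> a' = a) (\<lambda>_. [Add 3 3 4, Const 8 0])
        2 A"
        by (rule triple_block)
          (auto simp: phase_inv_def A_def set_reg_def regs_def d_def algebra_simps)
      moreover have "triple A row_loop ((n + 1) * 14) A'"
        unfolding A_def A'_def b
      proof (rule triple_row_loop)
        show "F (Suc (R + i)) k = (if Suc i \<le> k then F (Suc (R + i)) (k - Suc i) else 0) +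
          (if d \<le> k then F (R + i) (k - d) else 0)" if "k \<le> n" for k
          using rec[OF i that] by (simp only: d_def)
      qed (use mem i l d base_ge[of n "R + i"] in \<open>auto simp: mem_def\<close>)
      moreover have "triple A' (\<lambda>_. [Add 9 9 11, Add 2 2 7, Mul 14 2 2])
        3 (?I (Suc i))"
        using mem_written[OF mem, of w] out[OF i]
        by (intro triple_block)
          (auto simp: phase_inv_def A'_def set_reg_def regs_def d_def base_Suc[of _ "Suc _"] algebra_simps)
      ultimately have "triple (\<lambda>r a'. ?I i r a' \<and> a' = a)
        (seq (\<lambda>_. [Add 3 3 4, Const 8 0]) (seq row_loop (\<lambda>_. [Add 9 9 11, Add 2 2 7, Mul 14 2 2])))
        (2 + ((n + 1) * 14 + 3)) (?I (Suc i))"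
        by (intro triple_seq)
      then show "\<exists>c'. does
        (seq (\<lambda>_. [Add 3 3 4, Const 8 0]) (seq row_loop (\<lambda>_. [Add 9 9 11, Add 2 2 7, Mul 14 2 2])))
        (2 + ((n + 1) * 14 + 3)) c c' \<and> ?I (Suc i) (reg c') (arr c')"
        using c unfolding triple_def a_def by blast
    qed
    then show "triple (?I i)
      (seq (\<lambda>_. [Add 3 3 4, Const 8 0]) (seq row_loop (\<lambda>_. [Add 9 9 11, Add 2 2 7, Mul 14 2 2])))
      (14 * n + 19) (?I (Suc i))"
      by (simp add: algebra_simps)
  next
    fix i r a assume "i < l" "?I (Suc i) r a"
    then have "r 14 = int ((i + 2) * (i + 2))" "r 6 = int v + 1"
      by (auto simp: phase_inv_def regs_def algebra_simps)
    then have "r 14 < r 6 \<longleftrightarrow> (i + 2)\<^sup>2 \<le> v"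
      by (simp add: power2_eq_square del: of_nat_mult of_nat_add) linarith
    \<comment> \<open>\<open>(i + 2)^2 \<le> v\<close> means
      \<open>i + 2 \<le> floor_sqrt v = l\<close>.\<close>
    also have "\<dots> \<longleftrightarrow> Suc i < l"
      by (simp add: le_floor_sqrt_iff[symmetric] l(1)) linarith
    finally show "r 14 < r 6 \<longleftrightarrow> Suc i < l" .
  qed (use l in auto)
  then show ?thesis by (simp add: algebra_simps)
qed

section \<open>The three programs\<close>

text \<open>Row 0 is \<open>1, 0, 0, ...\<close> for both tables, and so is the initial output;
  register 9 becomes \<open>base n 1\<close>.\<close>

definition init_block :: program where
  "init_block = [Const 7 1, Add 11 0 7, Add 10 11 11, Store 10 7, Const 8 0, Store 8 7, Add 9 10 10,
     Const 2 1]"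

text \<open>The first phase has \<open>w = 0\<close>, so the output ends as row \<open>s\<close>;
  the second has \<open>w = 1\<close> and adds its rows. In between, register 2 holds
  \<open>s + 1\<close>, exactly the shift \<open>d\<close> needed next.\<close>

definition P_fragment :: fragment where
  "P_fragment = seq (\<lambda>_. init_block @ [Add 6 0 7])
     (seq phase (seq (\<lambda>_. [Const 12 0, Add 3 2 12, Const 2 1, Const 5 1]) phase))"

text \<open>Here \<open>v = 2 * n\<close>, and \<open>e = 1\<close> makes \<open>d = j\<close> in
  every row.\<close>

definition Q_fragment :: fragment where
  "Q_fragment = seq (\<lambda>_. init_block @ [Add 6 0 0, Add 6 6 7, Const 4 1, Const 5 1]) phase"

definition Q_parts_fragment :: fragment where
  "Q_parts_fragment = seq Q_fragment (\<lambda>_. [Add 12 1 7, Mul 12 12 10, Add 12 12 0, Load 0 12])"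

section \<open>Correctness of the three programs\<close>

definition initial :: "nat \<Rightarrow> nat \<Rightarrow> assertion" where
  "initial n m r a \<longleftrightarrow> r 0 = int n \<and> r 1 = int m \<and> (\<forall>i\<ge>2. r i = 0) \<and> a = (\<lambda>_. 0)"

lemma initial_init_config:
  "initial n 0 (reg (init_config [int n])) (\<lambda>_. 0)"
  "initial n m (reg (init_config [int n, int m])) (\<lambda>_. 0)"
  by (auto simp: initial_def init_config_def nth_Cons split: nat.splits)

lemma mem_initial:
  assumes "\<And>k. F 0 k = (if k = 0 then 1 else 0)" "\<And>k. out k = (if k = 0 then 1 else 0)"
  shows "mem n 0 F out ((\<lambda>_. 0)(2 * (n + 1) := 1, 0 := 1))"
  using assms by (auto simp: mem_def base_0)

lemma floor_sqrt_bounds: "(floor_sqrt v)\<^sup>2 \<le> v" "v < (floor_sqrt v + 1)\<^sup>2"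
  using Suc_floor_sqrt_power2_gt by auto

text \<open>This makes all shifts fit into the gaps of \<open>n + 1\<close> zeros.\<close>

lemma floor_sqrt_le_n: "v \<le> 2 * n \<Longrightarrow> floor_sqrt v \<le> n"
proof -
  assume v: "v \<le> 2 * n"
  show ?thesis
  proof (rule ccontr)
    assume "\<not> ?thesis"
    then have "(n + 1)\<^sup>2 \<le> (floor_sqrt v)\<^sup>2" by (intro power_mono) auto
    also have "\<dots> \<le> v" by (rule floor_sqrt_bounds)
    finally show False using v by (simp add: power2_eq_square)
  qed
qed

lemma triple_Q:
  assumes "n \<ge> 1"
  defines "l \<equiv> floor_sqrt (2 * n)"
  shows "triple (initial n m) Q_fragment (12 + l * (14 * n + 20))
    (\<lambda>r a. r 0 = int n \<and> r 1 = int m \<and> r 7 = 1 \<and> r 10 = 2 * (int n + 1) \<and>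
       mem n l (\<lambda>j k. Q_parts k j) Q a)"
proof -
  define F where "F = (\<lambda>j k. Q_parts k j)"
  define out where "out = (\<lambda>i k. \<Sum>j\<le>i. F j k)"
  let ?I = "phase_inv n m 0 1 1 (2 * n) 0 F out"
  have l: "l \<ge> 1" "l \<le> n"
    using assms floor_sqrt_le_n[of "2 * n" n] by (auto simp: l_def le_floor_sqrt_iff)
  have "mem n 0 F (out 0) ((\<lambda>_. 0)(2 * (n + 1) := 1, 0 := 1))"
    by (rule mem_initial) (simp_all add: F_def out_def Q_parts_0)
  moreover have "nat (2 * (int n + 1)) = 2 * (n + 1)" by simp
  ultimately have "triple (initial n m)
    (\<lambda>_. init_block @ [Add 6 0 0, Add 6 6 7, Const 4 1, Const 5 1]) 12 (?I 0)"
    by (intro triple_block)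
      (auto simp: init_block_def initial_def set_reg_def phase_inv_def regs_def base_Suc base_0
        nat_add_distrib)
  moreover have "triple (?I 0) phase (l * (14 * n + 20)) (?I l)"
    by (rule triple_phase) (use l in \<open>auto simp: F_def out_def l_def Q_parts_rec\<close>)
  ultimately have "triple (initial n m) Q_fragment (12 + l * (14 * n + 20)) (?I l)"
    unfolding Q_fragment_def by (rule triple_seq)
  moreover have "mem n l F Q a" if "mem n l F (out l) a" for a
  proof -
    have "Q k = out l k" if "k \<le> n" for k
      using Q_eq_sum[OF that] floor_sqrt_bounds(2)[of "2 * n"] by (simp add: l_def out_def F_def)
    then show ?thesis using that by (simp add: mem_def)
  qed
  ultimately show ?thesis
    by (elim triple_conseq) (auto simp: phase_inv_def regs_def F_def)
qed

text \<open>The program reads column \<open>n\<close> of row \<open>m\<close> without comparing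
  \<open>m\<close> with \<open>l\<close>: for \<open>m > l\<close> both the cell and
  \<open>Q_parts n m\<close> are 0.\<close>

lemma triple_Q_parts:
  assumes "n \<ge> 1"
  defines "l \<equiv> floor_sqrt (2 * n)"
  shows "triple (initial n m) Q_parts_fragment (12 + l * (14 * n + 20) + 4)
    (\<lambda>r a. r 0 = int (Q_parts n m))"
  unfolding Q_parts_fragment_def
proof (rule triple_seq)
  let ?B = "\<lambda>r a. r 0 = int n \<and> r 1 = int m \<and> r 7 = 1 \<and> r 10 = 2 * (int n + 1) \<and>
       mem n l (\<lambda>j k. Q_parts k j) Q a"
  show "triple (initial n m) Q_fragment (12 + l * (14 * n + 20)) ?B"
    using triple_Q[OF assms(1)] by (simp add: l_def)
  show "triple ?B (\<lambda>_. [Add 12 1 7, Mul 12 12 10, Add 12 12 0, Load 0 12]) 4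
    (\<lambda>r a. r 0 = int (Q_parts n m))"
  proof (rule triple_block)
    fix c :: config assume c: "?B (reg c) (arr c)"
    have addr: "(int m + 1) * (2 * int n + 2) + int n = int (base n m + n)"
      by (simp add: base_def algebra_simps)
    have "arr c (base n m + n) = int (Q_parts n m)"
    proof (cases "m \<le> l")
      case True
      then show ?thesis using c by (simp add: mem_def)
    next
      case False
      \<comment> \<open>Row \<open>m\<close> was never written.\<close>
      then have "base n (Suc l) \<le> base n m" by (intro base_mono) simp
      then have "arr c (base n m + n) = 0" using c by (simp add: mem_def base_Suc)
      moreover have "2 * n < m * (m + 1)"
      proof -
        have "2 * n < (l + 1)\<^sup>2" using floor_sqrt_bounds(2) by (simp add: l_def)
        also have "\<dots> \<le> m * (m + 1)"
          using False unfolding power2_eq_square by (intro mult_mono) auto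
        finally show ?thesis .
      qed
      ultimately show ?thesis by (simp add: Q_parts_eq_0)
    qed
    then show "\<exists>c'. exec_block [Add 12 1 7, Mul 12 12 10, Add 12 12 0, Load 0 12] c = Some c' \<and>
      reg c' 0 = int (Q_parts n m)"
      using c by (simp add: set_reg_def addr del: of_nat_add)
  qed simp_all
qed

lemma triple_P:
  assumes "n \<ge> 1"
  defines "s \<equiv> floor_sqrt n"
  shows "triple (initial n m) P_fragment
    (9 + (s * (14 * n + 20) + (4 + s * (14 * n + 20)))) (\<lambda>r a. \<forall>k\<le>n. a k = int (P k))"
proof -
  \<comment> \<open>One table with rows 0 to \<open>2 * s\<close>; the two families meet in row
    \<open>s\<close>.\<close>
  define F where "F = (\<lambda>r k. if r \<le> s then P_big r 0 k else P_big s (r - s) k)"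
  define out where "out = (\<lambda>i k. \<Sum>j\<le>i. P_big s j k)"
  \<comment> \<open>With \<open>w = 0\<close> the output after row \<open>i\<close> is that row, so
    \<open>F\<close> also serves as the output.\<close>
  let ?I = "phase_inv n m 0 0 0 n 0 F F" and ?J = "phase_inv n m (s + 1) 0 1 n s F out"
  have s: "s \<ge> 1" "s \<le> n"
    using assms floor_sqrt_le_n[of n n] by (auto simp: s_def le_floor_sqrt_iff)
  have "mem n 0 F (F 0) ((\<lambda>_. 0)(2 * (n + 1) := 1, 0 := 1))"
    by (rule mem_initial) (simp_all add: F_def P_big_0_0)
  moreover have "nat (2 * (int n + 1)) = 2 * (n + 1)" by simp
  ultimately have "triple (initial n m) (\<lambda>_. init_block @ [Add 6 0 7]) 9 (?I 0)"
    by (intro triple_block)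
      (auto simp: init_block_def initial_def set_reg_def phase_inv_def regs_def base_Suc base_0
        nat_add_distrib)
  moreover have "triple (?I 0) phase (s * (14 * n + 20)) (?I s)"
  proof (rule triple_phase)
    fix i k assume "i < s"
    then show "F (Suc (0 + i)) k = (if Suc i \<le> k then F (Suc (0 + i)) (k - Suc i) else 0) +
      (if 0 + 0 * Suc i \<le> k then F (0 + i) (k - (0 + 0 * Suc i)) else 0)"
      using P_big_small_rec[of "Suc i" k] by (simp add: F_def)
  qed (use s in \<open>auto simp: s_def\<close>)
  moreover have "triple (?I s) (\<lambda>_. [Const 12 0, Add 3 2 12, Const 2 1, Const 5 1]) 4 (?J 0)"
  proof -
    have "F s = out 0" by (simp add: F_def out_def fun_eq_iff)
    then show ?thesis
      by (intro triple_block) (auto simp: set_reg_def phase_inv_def regs_def)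
  qed
  moreover have "triple (?J 0) phase (s * (14 * n + 20)) (?J s)"
  proof (rule triple_phase)
    fix i k
    have "P_big s (Suc i) k = (if Suc i \<le> k then P_big s (Suc i) (k - Suc i) else 0) +
      (if s + 1 \<le> k then P_big s i (k - (s + 1)) else 0)"
      using P_big_rec[of "Suc i" s k] by simp
    moreover have "F (s + i) = P_big s i" by (simp add: F_def fun_eq_iff)
    moreover have "F (Suc (s + i)) = P_big s (Suc i)" by (simp add: F_def fun_eq_iff)
    ultimately show
      "F (Suc (s + i)) k = (if Suc i \<le> k then F (Suc (s + i)) (k - Suc i) else 0) +
       (if s + 1 + 0 * Suc i \<le> k then F (s + i) (k - (s + 1 + 0 * Suc i)) else 0)"
      by simp
  qed (use s in \<open>auto simp: s_def F_def out_def\<close>)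
  ultimately have "triple (initial n m) P_fragment
    (9 + (s * (14 * n + 20) + (4 + s * (14 * n + 20)))) (?J s)"
    unfolding P_fragment_def by (intro triple_seq)
  moreover have "out s k = P k" if "k \<le> n" for k
    using P_eq_sum[OF that] floor_sqrt_bounds(2)[of n] by (simp add: s_def out_def)
  ultimately show ?thesis
    by (elim triple_conseq) (auto simp: phase_inv_def mem_def)
qed

text \<open>One bound for all programs: the factor 2 covers the two phases for \<open>P\<close>, and
  20 covers the overheads 13, 12 and 16. With \<open>14 * n + 20 \<le> 34 * n\<close> the
  coefficient is at most 20 + 136.\<close>

lemma time_bound:
  assumes "n \<ge> 1" "v \<le> 2 * n" "t \<le> 20 + 2 * (floor_sqrt v * (14 * n + 20))"
  shows "real t \<le> 200 * real n powr (3/2)"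
proof -
  \<comment> \<open>The bound \<open>2 * n\<close> is relaxed to \<open>4 * n\<close>, whose root is
    \<open>2 * sqrt n\<close>.\<close>
  have "real ((floor_sqrt v)\<^sup>2) \<le> real (4 * n)"
    using floor_sqrt_bounds(1)[of v] assms(2) by (intro of_nat_mono) linarith
  then have "sqrt ((real (floor_sqrt v))\<^sup>2) \<le> sqrt (4 * real n)"
    by (intro real_sqrt_le_mono) simp
  then have l: "real (floor_sqrt v) \<le> 2 * sqrt n"
    by (simp add: real_sqrt_mult)
  have "real t \<le> real (20 + 2 * (floor_sqrt v * (14 * n + 20)))"
    using assms(3) of_nat_mono by blast
  also have "\<dots> = 20 + 2 * (real (floor_sqrt v) * (14 * real n + 20))" by simp
  also have "\<dots> \<le> 20 * (real n * sqrt n) + 2 * ((2 * sqrt n) * (34 * real n))"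
  proof (intro add_mono mult_mono l)
    have "1 * 1 \<le> real n * sqrt n" using assms(1) by (intro mult_mono) auto
    then show "20 \<le> 20 * (real n * sqrt n)" by simp
  qed (use assms(1) in auto)
  also have "\<dots> \<le> 200 * (real n * sqrt n)" by simp
  also have "real n * sqrt n = real n powr (3/2)"
    using assms(1) powr_add[of "real n" 1 "1/2"] by (simp add: powr_half_sqrt)
  finally show ?thesis .
qed

theorem mainTheorem4:
  "(\<exists>(p :: program) (C :: real). \<forall>n::nat. n \<ge> 1 \<longrightarrow>
      (\<exists>t c. halts_in p [int n] t c \<and> real t \<le> C * real n powr (3/2) \<and>
             outputs_list c (map (\<lambda>i. int (P i)) [0..<Suc n]))) \<and>
   (\<exists>(p :: program) (C :: real). \<forall>n::nat. n \<ge> 1 \<longrightarrow>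
      (\<exists>t c. halts_in p [int n] t c \<and> real t \<le> C * real n powr (3/2) \<and>
             outputs_list c (map (\<lambda>i. int (Q i)) [0..<Suc n]))) \<and>
   (\<exists>(p :: program) (C :: real). \<forall>(n::nat) (m::nat). n \<ge> 1 \<and> 1 \<le> m \<and> m \<le> n \<longrightarrow>
      (\<exists>t c. halts_in p [int n, int m] t c \<and> real t \<le> C * real n powr (3/2) \<and>
             outputs_number c (int (Q_parts n m))))"
proof (intro conjI)
  show "\<exists>(p :: program) (C :: real). \<forall>n::nat. n \<ge> 1 \<longrightarrow>
      (\<exists>t c. halts_in p [int n] t c \<and> real t \<le> C * real n powr (3/2) \<and>
             outputs_list c (map (\<lambda>i. int (P i)) [0..<Suc n]))"
  proof (rule exI, rule exI, intro allI impI)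
    fix n :: nat assume n: "n \<ge> 1"
    let ?t = "9 + (floor_sqrt n * (14 * n + 20) + (4 + floor_sqrt n * (14 * n + 20)))"
    obtain c where "halts_in (P_fragment 0) [int n] ?t c" "\<forall>k\<le>n. arr c k = int (P k)"
      using triple_halts_in[OF triple_P[OF n] initial_init_config(1)] by blast
    moreover have "real ?t \<le> 200 * real n powr (3/2)"
      by (rule time_bound[OF n, of n]) auto
    ultimately show "\<exists>t c. halts_in (P_fragment 0) [int n] t c \<and>
      real t \<le> 200 * real n powr (3/2) \<and> outputs_list c (map (\<lambda>i. int (P i)) [0..<Suc n])"
      by (intro exI[of _ ?t] exI[of _ c])
        (auto simp: outputs_list_def nth_append less_Suc_eq_le simp del: upt_Suc)
  qed
  show "\<exists>(p :: program) (C :: real). \<forall>n::nat. n \<ge> 1 \<longrightarrow>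
      (\<exists>t c. halts_in p [int n] t c \<and> real t \<le> C * real n powr (3/2) \<and>
             outputs_list c (map (\<lambda>i. int (Q i)) [0..<Suc n]))"
  proof (rule exI, rule exI, intro allI impI)
    fix n :: nat assume n: "n \<ge> 1"
    let ?t = "12 + floor_sqrt (2 * n) * (14 * n + 20)"
    obtain c l F where "halts_in (Q_fragment 0) [int n] ?t c" "mem n l F Q (arr c)"
      using triple_halts_in[OF triple_Q[OF n] initial_init_config(1)] by blast
    moreover have "real ?t \<le> 200 * real n powr (3/2)"
      by (rule time_bound[OF n, of "2 * n"]) auto
    ultimately show "\<exists>t c. halts_in (Q_fragment 0) [int n] t c \<and>
      real t \<le> 200 * real n powr (3/2) \<and> outputs_list c (map (\<lambda>i. int (Q i)) [0..<Suc n])"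
      by (intro exI[of _ ?t] exI[of _ c])
        (auto simp: outputs_list_def mem_def less_Suc_eq_le simp del: upt_Suc)
  qed
  show "\<exists>(p :: program) (C :: real). \<forall>(n::nat) (m::nat). n \<ge> 1 \<and> 1 \<le> m \<and> m \<le> n \<longrightarrow>
      (\<exists>t c. halts_in p [int n, int m] t c \<and> real t \<le> C * real n powr (3/2) \<and>
             outputs_number c (int (Q_parts n m)))"
  proof (rule exI, rule exI, intro allI impI)
    fix n m :: nat assume "n \<ge> 1 \<and> 1 \<le> m \<and> m \<le> n"
    then have n: "n \<ge> 1" by simp
    let ?t = "12 + floor_sqrt (2 * n) * (14 * n + 20) + 4"
    obtain c where "halts_in (Q_parts_fragment 0) [int n, int m] ?t c" "reg c 0 = int (Q_parts n m)"
      using triple_halts_in[OF triple_Q_parts[OF n] initial_init_config(2)] by blast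
    moreover have "real ?t \<le> 200 * real n powr (3/2)"
      by (rule time_bound[OF n, of "2 * n"]) auto
    ultimately show "\<exists>t c. halts_in (Q_parts_fragment 0) [int n, int m] t c \<and>
      real t \<le> 200 * real n powr (3/2) \<and> outputs_number c (int (Q_parts n m))"
      by (intro exI[of _ ?t] exI[of _ c]) (auto simp: outputs_number_def)
  qed
qed

end
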